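(* Let $f:\mathcal H\to\mathbb R$ be continuously differentiable, $\mu$-strongly convex and $L$-smooth with $\mu,L>0$, and let $x^*$ be its unique minimizer. Suppose the non-negative perturbation parameters $\Delta_1,\Delta_2$ and the step size $s>0$ satisfy: (1) $\Delta_2\sqrt{s}<\frac1L$; (2) $\frac{\sqrt{s}}{2}(1+\Delta_1)\le\Delta_2\le\sqrt{s}(1+\Delta_1)$. Then for any initial $x_0,v_0\in\mathcal H$, the sequence $\{x_k\}$ generated by $$\frac{x_{k+1}-x_k}{\sqrt{s}}=v_k,\qquad \frac{v_{k+1}-v_k}{\sqrt{s}}=-2\sqrt{\mu}\,v_{k+1}-(1+\Delta_1)\nabla f(x_{k+1})-\Delta_2\frac{\nabla f(x_{k+1})-\nabla f(x_k)}{\sqrt{s}}\qquad(k\ge0)$$ satisfies, for all $k\ge0$, $$f(x_k)-f(x^* )\le\frac{1}{(1-L\Delta_2\sqrt{s})(1+\Delta_1)}\Big(1+\frac{\sqrt{\mu s}}{1+\sqrt{\mu s}}\Big)^{-k}E(0),$$ where $$E(0)=(1+\Delta_1)\Big(f(x_0)-f(x^* )-\frac{\Delta_2\sqrt{s}}{2}\|\nabla f(x_0)\|^2\Big)+\frac12\|v_0+\sqrt{\mu}(x_1-x^* )+\Delta_2\nabla f(x_0)\|^2 .$$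
   Context: $\mathcal H$ is a real finite-dimensional Hilbert space with inner product $\langle\cdot,\cdot\rangle$ and induced norm $\|\cdot\|$. A continuously differentiable $f$ is $\mu$-strongly convex if $f(y)-f(x)\ge\langle\nabla f(x),y-x\rangle+\frac{\mu}{2}\|y-x\|^2$ for all $x,y\in\mathcal H$, and $L$-smooth if $\|\nabla f(x)-\nabla f(y)\|\le L\|x-y\|$ for all $x,y\in\mathcal H$. The scheme (symplectic Euler discretization) is equivalently $x_1=x_0+\sqrt s\,v_0$ and, for $k\ge1$, $x_{k+1}=x_k+\frac{1}{1+2\sqrt{\mu s}}(x_k-x_{k-1})-\frac{1+\Delta_1}{1+2\sqrt{\mu s}}s\nabla f(x_k)-\frac{\Delta_2\sqrt{s}}{1+2\sqrt{\mu s}}(\nabla f(x_k)-\nabla f(x_{k-1}))$. *)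

theory Defs
  imports "HOL-Analysis.Analysis"
begin

text \<open>The value is meaningful only where the function is differentiable.\<close>

definition grad :: "('a::real_inner \<Rightarrow> real) \<Rightarrow> 'a \<Rightarrow> 'a" where
  "grad f x = (THE D. GDERIV f x :> D)"

lemma grad_eqI:
  assumes "GDERIV f x :> D"
  shows "grad f x = D"
  unfolding grad_def
proof (rule the_equality)
  show "GDERIV f x :> D" by fact
next
  fix D' assume "GDERIV f x :> D'"
  with assms have "(\<lambda>h. inner h D') = (\<lambda>h. inner h D)"
    unfolding gderiv_def by (rule has_derivative_unique[rotated])
  then have "inner (D' - D) D' = inner (D' - D) D" by (rule fun_cong)
  then have "inner (D' - D) (D' - D) = 0" by (simp add: inner_diff_right)
  then show "D' = D" by simp
qed

definition continuously_differentiable :: "('a::real_inner \<Rightarrow> real) \<Rightarrow> bool" where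
  "continuously_differentiable f \<longleftrightarrow>
     (\<forall>x. GDERIV f x :> grad f x) \<and> continuous_on UNIV (grad f)"

text \<open>The next two notions are intended for continuously differentiable functions only; that
  hypothesis is kept separate.\<close>

definition strongly_convex :: "real \<Rightarrow> ('a::real_inner \<Rightarrow> real) \<Rightarrow> bool" where
  "strongly_convex \<mu> f \<longleftrightarrow>
     (\<forall>x y. f y - f x \<ge> inner (grad f x) (y - x) + \<mu> / 2 * (norm (y - x))\<^sup>2)"

definition smooth :: "real \<Rightarrow> ('a::real_inner \<Rightarrow> real) \<Rightarrow> bool" where
  "smooth L f \<longleftrightarrow> (\<forall>x y. norm (grad f x - grad f y) \<le> L * norm (x - y))"

end

theory Submission
  imports Defs
begin

text \<open>
  Write \<open>h = sqrt s\<close>, \<open>q = sqrt \<mu>\<close>, \<open>a = 1 + \<Delta>\<^sub>1\<close> and \<open>D = \<Delta>\<^sub>2\<close>. The right-hand side of the claim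
  contains the value at \<open>k = 0\<close> of the energy
  \<open>E k = a (f (x k) - f x* - D h / 2 |g k|\<^sup>2) + 1/2 |w k|\<^sup>2\<close>, where \<open>g k = grad f (x k)\<close> and
  \<open>w k = v k + q (x (k+1) - x*) + D g k\<close>. The proof shows that \<open>(1 + r) E (k+1) \<le> E k\<close>
  with \<open>r = q h / (1 + q h)\<close> (lemma \<open>energy_step\<close>), and that the energy
  dominates \<open>a (1 - L D h) (f (x k) - f x*)\<close> (lemma \<open>energy_ge_gap\<close>).

  The vector \<open>w\<close> is chosen so that the gradient differences and half of the friction drop out of
  its increment: \<open>w (k+1) - w k = - h (q v (k+1) + a g (k+1))\<close>. The increment of \<open>f\<close> is bounded by
  \<open>h \<langle>g (k+1), v k\<rangle> - 1/(2L) |g (k+1) - g k|\<^sup>2\<close> (lemma \<open>smooth_convex_lower_bound\<close>), and inserting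
  the scheme for \<open>v k\<close> produces the term \<open>a D h \<langle>g (k+1), g (k+1) - g k\<rangle>\<close>, which the correction
  \<open>- D h / 2 |g|\<^sup>2\<close> in the energy cancels up to \<open>a D h / 2 |g (k+1) - g k|\<^sup>2\<close>. Condition (1),
  \<open>D h < 1/L\<close>, absorbs this remainder.

  In the resulting bound for \<open>E (k+1) - E k + r E (k+1)\<close> the products of \<open>v (k+1)\<close> with the gradient
  and with the position cancel, precisely because \<open>r (1 + q h) = q h\<close>. Strong
  convexity bounds \<open>f (x (k+1)) - f x*\<close> by \<open>\<langle>g (k+1), x (k+1) - x*\<rangle> - \<mu>/2 |x (k+1) - x*|\<^sup>2\<close>, and its
  quadratic term makes up for the square of \<open>q (x (k+1) - x*)\<close> in \<open>r/2 |w (k+1)|\<^sup>2\<close>, since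
  \<open>q\<^sup>2 = \<mu>\<close> and \<open>a \<ge> 1\<close>. What remains is a non-positive multiple of \<open>|v (k+1)|\<^sup>2\<close>, the multiple \<open>a h (a h / 2 - D) + r D / 2 (D - a h)\<close> of
  \<open>|g (k+1)|\<^sup>2\<close> and the multiple \<open>r q (D - a h)\<close> of \<open>\<langle>g (k+1), x (k+1) - x*\<rangle>\<close>. The two bounds in
  condition (2) are what makes these last two coefficients non-positive, and the inner product
  is non-negative by convexity.
\<close>

section \<open>Smooth convex functions\<close>

text \<open>Along the segment from \<open>x\<close> to \<open>y\<close>, the difference between the function and the claimed
  quadratic majorant has a non-positive derivative, by the Lipschitz bound on the gradient and
  Cauchy-Schwarz.\<close>

lemma smooth_quadratic_upper_bound:
  fixes f :: "'a::real_inner \<Rightarrow> real"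
  assumes C1: "continuously_differentiable f" and sm: "smooth L f"
  shows "f y \<le> f x + inner (grad f x) (y - x) + L / 2 * (norm (y - x))\<^sup>2"
proof -
  define d where "d = y - x"
  define \<phi> where "\<phi> t = f (x + t *\<^sub>R d) - t * inner (grad f x) d - L / 2 * t\<^sup>2 * (norm d)\<^sup>2" for t
  define \<phi>' where "\<phi>' t = inner (grad f (x + t *\<^sub>R d)) d - inner (grad f x) d - L * t * (norm d)\<^sup>2"
    for t
  have deriv: "(\<phi> has_real_derivative \<phi>' t) (at t)" for t
  proof -
    have "GDERIV f (x + t *\<^sub>R d) :> grad f (x + t *\<^sub>R d)"
      using C1 unfolding continuously_differentiable_def by blast
    then have "(f has_derivative (\<lambda>u. inner u (grad f (x + t *\<^sub>R d)))) (at (x + t *\<^sub>R d))"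
      by (simp add: gderiv_def)
    moreover have "((\<lambda>t. x + t *\<^sub>R d) has_derivative (\<lambda>u. u *\<^sub>R d)) (at t)"
      by (auto intro!: derivative_eq_intros)
    ultimately have "((\<lambda>t. f (x + t *\<^sub>R d)) has_derivative
        (\<lambda>u. inner (u *\<^sub>R d) (grad f (x + t *\<^sub>R d)))) (at t)"
      by (rule has_derivative_compose[rotated])
    then have "((\<lambda>t. f (x + t *\<^sub>R d)) has_real_derivative inner (grad f (x + t *\<^sub>R d)) d) (at t)"
      by (simp add: has_field_derivative_def inner_commute mult.commute[of _ "inner _ _"])
    then show ?thesis
      unfolding \<phi>_def \<phi>'_def by (auto intro!: derivative_eq_intros simp: power2_eq_square)
  qed
  have "\<phi>' t \<le> 0" if "0 \<le> t" for t
  proof -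
    have "inner (grad f (x + t *\<^sub>R d) - grad f x) d \<le> norm (grad f (x + t *\<^sub>R d) - grad f x) * norm d"
      by (rule norm_cauchy_schwarz)
    also have "\<dots> \<le> (L * norm ((x + t *\<^sub>R d) - x)) * norm d"
      using sm unfolding smooth_def by (blast intro: mult_right_mono norm_ge_zero)
    also have "\<dots> = L * t * (norm d)\<^sup>2"
      using that by (simp add: power2_eq_square)
    finally show ?thesis by (simp add: \<phi>'_def inner_diff_left)
  qed
  then have "\<phi> 1 \<le> \<phi> 0"
    using deriv by (intro DERIV_nonpos_imp_nonincreasing[of 0 1 \<phi>]) auto
  then show ?thesis by (simp add: \<phi>_def d_def)
qed

text \<open>The minimum can undercut \<open>f x\<close> by no less than what one gradient step of length \<open>1/L\<close>
  gains.\<close>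

lemma smooth_norm_grad_le_gap:
  fixes f :: "'a::real_inner \<Rightarrow> real"
  assumes C1: "continuously_differentiable f" and sm: "smooth L f" and L: "L > 0"
    and lower: "\<And>z. m \<le> f z"
  shows "(norm (grad f x))\<^sup>2 \<le> 2 * L * (f x - m)"
proof -
  define g where "g = grad f x"
  have "m \<le> f (x - (1 / L) *\<^sub>R g)" by (rule lower)
  also have "\<dots> \<le> f x + inner g (- ((1 / L) *\<^sub>R g)) + L / 2 * (norm (- ((1 / L) *\<^sub>R g)))\<^sup>2"
    using smooth_quadratic_upper_bound[OF C1 sm, of "x - (1 / L) *\<^sub>R g" x] by (simp add: g_def)
  also have "\<dots> = f x - (norm g)\<^sup>2 / (2 * L)"
    using L by (simp add: power_divide power2_norm_eq_inner[symmetric] power_mult_distrib)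
      (simp add: field_simps power2_eq_square)
  finally show ?thesis using L by (simp add: g_def field_simps)
qed

text \<open>Compare the two bounds on \<open>f z\<close> at \<open>z = x - (grad f x - grad f y) / L\<close>: from below by the
  tangent at \<open>y\<close>, from above by the quadratic majorant at \<open>x\<close>. This \<open>z\<close> minimises the gap between
  the majorant and the tangent.\<close>

lemma smooth_convex_lower_bound:
  fixes f :: "'a::real_inner \<Rightarrow> real"
  assumes C1: "continuously_differentiable f" and sm: "smooth L f" and L: "L > 0"
    and tangent: "\<And>x y. f x + inner (grad f x) (y - x) \<le> f y"
  shows "f y + inner (grad f y) (x - y) + 1 / (2 * L) * (norm (grad f x - grad f y))\<^sup>2 \<le> f x"
proof -
  define u where "u = grad f x - grad f y"
  define z where "z = x - (1 / L) *\<^sub>R u"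
  have "f y + inner (grad f y) (z - y) \<le> f z" by (rule tangent)
  also have "\<dots> \<le> f x + inner (grad f x) (z - x) + L / 2 * (norm (z - x))\<^sup>2"
    by (rule smooth_quadratic_upper_bound[OF C1 sm])
  finally have le: "f y + inner (grad f y) (z - y)
      \<le> f x + inner (grad f x) (z - x) + L / 2 * (norm (z - x))\<^sup>2" .
  have "inner (grad f y) (z - y) = inner (grad f y) (x - y) - inner (grad f y) u / L"
    by (simp add: z_def inner_diff_right)
  moreover have "inner (grad f x) (z - x) = - (inner (grad f x) u / L)"
    by (simp add: z_def)
  moreover have "L / 2 * (norm (z - x))\<^sup>2 = (norm u)\<^sup>2 / (2 * L)"
    using L by (simp add: z_def power_divide) (simp add: field_simps power2_eq_square)
  moreover have "inner (grad f x) u / L - inner (grad f y) u / L = (norm u)\<^sup>2 / L"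
    by (simp add: u_def power2_norm_eq_inner inner_diff_left diff_divide_distrib[symmetric])
  ultimately have "f y + inner (grad f y) (x - y) + ((norm u)\<^sup>2 / L - (norm u)\<^sup>2 / (2 * L)) \<le> f x"
    using le by linarith
  moreover have "(norm u)\<^sup>2 / L - (norm u)\<^sup>2 / (2 * L) = 1 / (2 * L) * (norm u)\<^sup>2"
    using L by (simp add: field_simps)
  ultimately show ?thesis by (simp add: u_def)
qed

section \<open>The energy and its decay\<close>

text \<open>The position \<open>x + h v\<close> inside the norm is the next iterate, so that the energy depends on the
  current state \<open>(x, v)\<close> only.\<close>

definition energy ::
    "real \<Rightarrow> real \<Rightarrow> real \<Rightarrow> real \<Rightarrow> ('a::real_inner \<Rightarrow> real) \<Rightarrow> 'a \<Rightarrow> 'a \<Rightarrow> 'a \<Rightarrow> real" where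
  "energy a D h q f z x v =
     a * (f x - f z - D * h / 2 * (norm (grad f x))\<^sup>2)
     + 1 / 2 * (norm (v + q *\<^sub>R (x + h *\<^sub>R v - z) + D *\<^sub>R grad f x))\<^sup>2"

text \<open>Only the quadratic correction \<open>- D h / 2 |grad f x|\<^sup>2\<close> can be negative, and it costs at most the
  fraction \<open>L D h\<close> of the gap.\<close>

lemma energy_ge_gap:
  fixes f :: "'a::real_inner \<Rightarrow> real"
  assumes C1: "continuously_differentiable f" and sm: "smooth L f" and L: "L > 0"
    and minimum: "\<And>y. f z \<le> f y"
    and "a \<ge> 0" "D \<ge> 0" "h \<ge> 0"
  shows "a * (1 - L * D * h) * (f x - f z) \<le> energy a D h q f z x v"
proof -
  have "D * h / 2 * (norm (grad f x))\<^sup>2 \<le> D * h / 2 * (2 * L * (f x - f z))"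
    using smooth_norm_grad_le_gap[OF C1 sm L minimum] assms(6,7) by (intro mult_left_mono) auto
  then have "(1 - L * D * h) * (f x - f z) \<le> f x - f z - D * h / 2 * (norm (grad f x))\<^sup>2"
    by (simp add: algebra_simps)
  then have "a * ((1 - L * D * h) * (f x - f z))
      \<le> a * (f x - f z - D * h / 2 * (norm (grad f x))\<^sup>2)"
    using assms(5) by (rule mult_left_mono)
  moreover have "0 \<le> 1 / 2 * (norm (v + q *\<^sub>R (x + h *\<^sub>R v - z) + D *\<^sub>R grad f x))\<^sup>2"
    by simp
  ultimately show ?thesis unfolding energy_def by (simp only: mult.assoc)
qed

text \<open>With \<open>y = x' - z\<close>, everything is a combination of the inner products of \<open>v'\<close>, \<open>y\<close>, \<open>g'\<close> and
  \<open>u = g' - g\<close>. The upper bound for \<open>f x' - f x\<close>, the strong convexity bound for \<open>f x' - f z\<close> and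
  the signs of the remaining coefficients then give the decay.\<close>

lemma energy_step:
  fixes f :: "'a::real_inner \<Rightarrow> real"
  assumes C1: "continuously_differentiable f" and sm: "smooth L f" and L: "L > 0"
    and sc: "strongly_convex (q\<^sup>2) f"
    and minimum: "\<And>y. f z \<le> f y"
    and q: "q \<ge> 0" and h: "h > 0" and a: "a \<ge> 1" and D: "D \<ge> 0"
    and Dh: "D * h \<le> 1 / L" and D_ge: "h / 2 * a \<le> D" and D_le: "D \<le> h * a"
    and x': "x' = x + h *\<^sub>R v"
    and v': "v' - v = - (2 * q * h) *\<^sub>R v' - (a * h) *\<^sub>R grad f x'
                - D *\<^sub>R (grad f x' - grad f x)"
  shows "(1 + q * h / (1 + q * h)) * energy a D h q f z x' v' \<le> energy a D h q f z x v"
proof -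
  define r where "r = q * h / (1 + q * h)"
  define g where "g = grad f x"
  define g' where "g' = grad f x'"
  define u where "u = g' - g"
  define y where "y = x' - z"
  define w where "w = v + q *\<^sub>R (x + h *\<^sub>R v - z) + D *\<^sub>R g"
  define w' where "w' = v' + q *\<^sub>R (x' + h *\<^sub>R v' - z) + D *\<^sub>R g'"
  define d where "d = (q * h) *\<^sub>R v' + (a * h) *\<^sub>R g'"
  have qh: "q * h \<ge> 0" using q h by simp
  have r_pos: "r \<ge> 0" using qh by (simp add: r_def)
  have r: "r * (1 + q * h) = q * h" using qh by (simp add: r_def)
  have v: "v = (1 + 2 * q * h) *\<^sub>R v' + (a * h) *\<^sub>R g' + D *\<^sub>R u"
    using v' by (simp add: g'_def g_def u_def algebra_simps)
  have g: "g = g' - u" by (simp add: u_def)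
  have w'_eq: "w' = (1 + q * h) *\<^sub>R v' + (q *\<^sub>R y + D *\<^sub>R g')"
    by (simp add: w'_def y_def algebra_simps)
  have w_eq: "w = w' + d"
    unfolding w_def w'_def d_def x'[symmetric] unfolding v g
    by (simp add: algebra_simps) (simp add: mult_ac flip: scaleR_2)

  have tangent: "f x + inner (grad f x) (y - x) \<le> f y" for x y
  proof -
    have "f y - f x \<ge> inner (grad f x) (y - x) + q\<^sup>2 / 2 * (norm (y - x))\<^sup>2"
      using sc by (simp add: strongly_convex_def)
    moreover have "0 \<le> q\<^sup>2 / 2 * (norm (y - x))\<^sup>2" by simp
    ultimately show ?thesis by linarith
  qed

  have "f x' + inner g' (x - x') + 1 / (2 * L) * (norm (g - g'))\<^sup>2 \<le> f x"
    using smooth_convex_lower_bound[OF C1 sm L tangent, of x' x] by (simp add: g_def g'_def)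
  moreover have "inner g' (x - x') = - (h * inner g' v)" by (simp add: x')
  ultimately have f_increment: "f x' - f x \<le> h * inner g' v - 1 / (2 * L) * inner u u"
    by (simp add: u_def norm_minus_commute[of g g'] power2_norm_eq_inner)
  also have "inner g' v = (1 + 2 * q * h) * inner v' g' + a * h * inner g' g' + D * inner g' u"
    by (simp add: v inner_add_right inner_commute)
  finally have f_bound: "a * (f x' - f x)
      \<le> a * (h * ((1 + 2 * q * h) * inner v' g' + a * h * inner g' g' + D * inner g' u)
             - 1 / (2 * L) * inner u u)"
    using a by (intro mult_left_mono) auto
  have gg: "(norm g)\<^sup>2 = inner g' g' - 2 * inner g' u + inner u u"
    by (simp add: g power2_norm_eq_inner algebra_simps inner_commute)

  have w_increment: "(norm w')\<^sup>2 / 2 - (norm w)\<^sup>2 / 2 = - inner w' d - inner d d / 2"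
    by (simp add: w_eq power2_norm_eq_inner inner_add_left inner_add_right inner_commute
        field_simps)
  have w'd: "inner w' d = q * h * (1 + q * h) * inner v' v' + q\<^sup>2 * h * inner v' y
      + (q * h * D + a * h * (1 + q * h)) * inner v' g' + a * q * h * inner y g'
      + a * h * D * inner g' g'"
    by (simp add: w'_eq d_def inner_add_left inner_add_right inner_commute algebra_simps
        power2_eq_square)
  have dd: "inner d d = (q * h)\<^sup>2 * inner v' v' + 2 * a * q * h\<^sup>2 * inner v' g'
      + (a * h)\<^sup>2 * inner g' g'"
    by (simp add: d_def inner_add_left inner_add_right inner_commute algebra_simps
        power2_eq_square)
  have increment: "energy a D h q f z x' v' - energy a D h q f z x v
      \<le> - (q * h * (1 + q * h) + (q * h)\<^sup>2 / 2) * inner v' v' - q * h * D * inner v' g'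
        - q\<^sup>2 * h * inner v' y - a * q * h * inner y g' + a * h * (a * h / 2 - D) * inner g' g'
        + a / 2 * (D * h - 1 / L) * inner u u"
  proof -
    have "energy a D h q f z x' v' - energy a D h q f z x v
      = a * (f x' - f x) - a * D * h / 2 * (inner g' g' - (norm g)\<^sup>2)
        + ((norm w')\<^sup>2 / 2 - (norm w)\<^sup>2 / 2)"
      unfolding energy_def w_def[symmetric] w'_def[symmetric] g_def[symmetric] g'_def[symmetric]
      by (simp add: power2_norm_eq_inner[symmetric] algebra_simps)
    also have "\<dots> \<le> a * (h * ((1 + 2 * q * h) * inner v' g' + a * h * inner g' g' + D * inner g' u)
             - 1 / (2 * L) * inner u u) - a * D * h / 2 * (inner g' g' - (norm g)\<^sup>2)
        + ((norm w')\<^sup>2 / 2 - (norm w)\<^sup>2 / 2)"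
      using f_bound by simp
    also have "\<dots> = - (q * h * (1 + q * h) + (q * h)\<^sup>2 / 2) * inner v' v' - q * h * D * inner v' g'
        - q\<^sup>2 * h * inner v' y - a * q * h * inner y g' + a * h * (a * h / 2 - D) * inner g' g'
        + a / 2 * (D * h - 1 / L) * inner u u"
      unfolding w_increment w'd dd gg by (simp add: field_simps power2_eq_square)
    finally show ?thesis .
  qed

  \<comment> \<open>The identity \<open>r (1 + q h) = q h\<close> turns the mixed products with \<open>v'\<close> into the negatives of
    those in the increment.\<close>
  have r_norm_w': "r * ((norm w')\<^sup>2 / 2) = q * h * (1 + q * h) / 2 * inner v' v'
      + q\<^sup>2 * h * inner v' y + q * h * D * inner v' g'
      + r / 2 * (q\<^sup>2 * inner y y + 2 * q * D * inner y g' + D\<^sup>2 * inner g' g')"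
  proof -
    have "(norm w')\<^sup>2 / 2 = (1 + q * h) * ((1 + q * h) / 2 * inner v' v'
        + q * inner v' y + D * inner v' g')
        + 1 / 2 * (q\<^sup>2 * inner y y + 2 * q * D * inner y g' + D\<^sup>2 * inner g' g')"
      unfolding w'_eq power2_norm_eq_inner
      by (simp add: inner_add_left inner_add_right inner_commute field_simps power2_eq_square)
    then have "r * ((norm w')\<^sup>2 / 2) = (r * (1 + q * h)) * ((1 + q * h) / 2 * inner v' v'
        + q * inner v' y + D * inner v' g')
        + r / 2 * (q\<^sup>2 * inner y y + 2 * q * D * inner y g' + D\<^sup>2 * inner g' g')"
      by (simp add: algebra_simps)
    then show ?thesis unfolding r by (simp add: algebra_simps power2_eq_square)
  qed

  have gap: "f x' - f z \<le> inner y g' - q\<^sup>2 / 2 * inner y y"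
  proof -
    have "f z - f x' \<ge> inner (grad f x') (z - x') + q\<^sup>2 / 2 * (norm (z - x'))\<^sup>2"
      using sc by (simp add: strongly_convex_def)
    moreover have "inner (grad f x') (z - x') = - inner y g'"
      by (simp add: y_def g'_def inner_diff_right inner_diff_left inner_commute)
    moreover have "(norm (z - x'))\<^sup>2 = inner y y"
      by (simp add: y_def norm_minus_commute[of z] power2_norm_eq_inner)
    ultimately show ?thesis by simp
  qed
  have "0 \<le> q\<^sup>2 / 2 * inner y y" by simp
  then have yg_pos: "inner y g' \<ge> 0" using gap minimum[of x'] by linarith
  have r_gap: "r * a * (f x' - f z) + r / 2 * q\<^sup>2 * inner y y \<le> r * a * inner y g'"
  proof -
    have "r * a * (f x' - f z) \<le> r * a * (inner y g' - q\<^sup>2 / 2 * inner y y)"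
      using gap r_pos a by (intro mult_left_mono) auto
    moreover have "r * (q\<^sup>2 / 2 * inner y y) \<le> r * a * (q\<^sup>2 / 2 * inner y y)"
      using r_pos a by (intro mult_right_mono) (auto simp: mult_le_cancel_left1)
    ultimately show ?thesis by (simp add: algebra_simps)
  qed

  have "energy a D h q f z x' v' - energy a D h q f z x v + r * energy a D h q f z x' v'
      \<le> - (q * h * (1 + q * h) / 2 + (q * h)\<^sup>2 / 2) * inner v' v'
        + (r * a + r * q * D - a * (q * h)) * inner y g'
        + (a * h * (a * h / 2 - D) + r * D / 2 * (D - a * h)) * inner g' g'
        + a / 2 * (D * h - 1 / L) * inner u u"
  proof -
    have "r * energy a D h q f z x' v'
        = r * a * (f x' - f z) - r * a * D * h / 2 * inner g' g' + r * ((norm w')\<^sup>2 / 2)"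
      unfolding energy_def w'_def[symmetric] g'_def[symmetric]
      by (simp add: power2_norm_eq_inner[symmetric] algebra_simps)
    then have "energy a D h q f z x' v' - energy a D h q f z x v + r * energy a D h q f z x' v'
        = (energy a D h q f z x' v' - energy a D h q f z x v)
        + (r * a * (f x' - f z) + r / 2 * q\<^sup>2 * inner y y)
        + (q * h * (1 + q * h) / 2 * inner v' v' + q\<^sup>2 * h * inner v' y + q * h * D * inner v' g'
           + r * q * D * inner y g' + r / 2 * D\<^sup>2 * inner g' g' - r * a * D * h / 2 * inner g' g')"
      unfolding r_norm_w' by (simp add: algebra_simps)
    also have "\<dots> \<le> (- (q * h * (1 + q * h) + (q * h)\<^sup>2 / 2) * inner v' v' - q * h * D * inner v' g'
        - q\<^sup>2 * h * inner v' y - a * q * h * inner y g' + a * h * (a * h / 2 - D) * inner g' g'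
        + a / 2 * (D * h - 1 / L) * inner u u)
        + r * a * inner y g'
        + (q * h * (1 + q * h) / 2 * inner v' v' + q\<^sup>2 * h * inner v' y + q * h * D * inner v' g'
           + r * q * D * inner y g' + r / 2 * D\<^sup>2 * inner g' g' - r * a * D * h / 2 * inner g' g')"
      by (intro add_right_mono add_mono increment r_gap)
    also have "\<dots> = - (q * h * (1 + q * h) / 2 + (q * h)\<^sup>2 / 2) * inner v' v'
        + (r * a + r * q * D - a * (q * h)) * inner y g'
        + (a * h * (a * h / 2 - D) + r * D / 2 * (D - a * h)) * inner g' g'
        + a / 2 * (D * h - 1 / L) * inner u u"
      by (simp add: field_simps power2_eq_square)
    finally show ?thesis .
  qed
  also have "r * a + r * q * D - a * (q * h) = r * q * (D - a * h)"
  proof -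
    have "r * a + r * q * D - a * (q * h) = r * a + r * q * D - a * (r * (1 + q * h))"
      by (simp only: r)
    then show ?thesis by (simp add: algebra_simps)
  qed
  also have "- (q * h * (1 + q * h) / 2 + (q * h)\<^sup>2 / 2) * inner v' v'
        + r * q * (D - a * h) * inner y g'
        + (a * h * (a * h / 2 - D) + r * D / 2 * (D - a * h)) * inner g' g'
        + a / 2 * (D * h - 1 / L) * inner u u \<le> 0"
  proof -
    have "0 \<le> q * h * (1 + q * h) / 2 + (q * h)\<^sup>2 / 2" using qh by simp
    then have "- (q * h * (1 + q * h) / 2 + (q * h)\<^sup>2 / 2) * inner v' v' \<le> 0"
      by (intro mult_nonpos_nonneg) auto
    moreover have "r * q * (D - a * h) * inner y g' \<le> 0"
      using r_pos q D_le yg_pos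
      by (intro mult_nonpos_nonneg mult_nonneg_nonpos) (auto simp: mult.commute)
    moreover have "(a * h * (a * h / 2 - D) + r * D / 2 * (D - a * h)) * inner g' g' \<le> 0"
      using r_pos D_le D_ge D a h
      by (intro mult_nonpos_nonneg add_nonpos_nonpos mult_nonneg_nonpos) (auto simp: mult.commute)
    moreover have "a / 2 * (D * h - 1 / L) * inner u u \<le> 0"
      using a Dh by (intro mult_nonpos_nonneg mult_nonneg_nonpos) auto
    ultimately show ?thesis by linarith
  qed
  finally show ?thesis
    unfolding r_def[symmetric] by (simp add: distrib_right)
qed

section \<open>Convergence of the scheme\<close>

theorem corollary1:
  fixes f :: "'a::euclidean_space \<Rightarrow> real"
    and xstar x0 v0 :: 'a
    and x v :: "nat \<Rightarrow> 'a"
    and \<mu> L \<Delta>\<^sub>1 \<Delta>\<^sub>2 s :: real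
  assumes "\<mu> > 0" and "L > 0"
    and "continuously_differentiable f"
    and "strongly_convex \<mu> f"
    and "smooth L f"
    and "is_arg_min f (\<lambda>_. True) xstar"
    and "\<Delta>\<^sub>1 \<ge> 0" and "\<Delta>\<^sub>2 \<ge> 0" and "s > 0"
    and "\<Delta>\<^sub>2 * sqrt s < 1 / L"
    and "sqrt s / 2 * (1 + \<Delta>\<^sub>1) \<le> \<Delta>\<^sub>2" and "\<Delta>\<^sub>2 \<le> sqrt s * (1 + \<Delta>\<^sub>1)"
    and "x 0 = x0" and "v 0 = v0"
    and "\<And>k. (x (Suc k) - x k) /\<^sub>R sqrt s = v k"
    and "\<And>k. (v (Suc k) - v k) /\<^sub>R sqrt s =
           - (2 * sqrt \<mu>) *\<^sub>R v (Suc k) - (1 + \<Delta>\<^sub>1) *\<^sub>R grad f (x (Suc k))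
           - \<Delta>\<^sub>2 *\<^sub>R ((grad f (x (Suc k)) - grad f (x k)) /\<^sub>R sqrt s)"
  shows "\<forall>k. f (x k) - f xstar \<le>
           1 / ((1 - L * \<Delta>\<^sub>2 * sqrt s) * (1 + \<Delta>\<^sub>1))
           * (1 + sqrt (\<mu> * s) / (1 + sqrt (\<mu> * s))) powi (- int k)
           * ((1 + \<Delta>\<^sub>1) * (f x0 - f xstar - \<Delta>\<^sub>2 * sqrt s / 2 * (norm (grad f x0))\<^sup>2)
              + 1 / 2 * (norm (v0 + sqrt \<mu> *\<^sub>R (x 1 - xstar) + \<Delta>\<^sub>2 *\<^sub>R grad f x0))\<^sup>2)"
proof
  fix k
  define h where "h = sqrt s"
  define q where "q = sqrt \<mu>"
  define a where "a = 1 + \<Delta>\<^sub>1"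
  define r where "r = q * h / (1 + q * h)"
  define E where "E k = energy a \<Delta>\<^sub>2 h q f xstar (x k) (v k)" for k
  have h: "h > 0" and q: "q > 0" and a: "a \<ge> 1" and qq: "q\<^sup>2 = \<mu>"
    using assms(1,7,9) by (auto simp: h_def q_def a_def)
  have r: "r > 0" using h q by (simp add: r_def add_pos_pos)
  have minimum: "f xstar \<le> f y" for y
    using assms(6) by (auto simp: is_arg_min_def not_less)
  have x_next: "x (Suc k) = x k + h *\<^sub>R v k" for k
    unfolding assms(15)[of k, symmetric] using h by (simp add: h_def[symmetric])
  have v_step: "v (Suc k) - v k = - (2 * q * h) *\<^sub>R v (Suc k) - (a * h) *\<^sub>R grad f (x (Suc k))
      - \<Delta>\<^sub>2 *\<^sub>R (grad f (x (Suc k)) - grad f (x k))" for k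
  proof -
    have "v (Suc k) - v k = h *\<^sub>R ((v (Suc k) - v k) /\<^sub>R h)" using h by simp
    also have "\<dots> = h *\<^sub>R (- (2 * q) *\<^sub>R v (Suc k) - a *\<^sub>R grad f (x (Suc k))
        - \<Delta>\<^sub>2 *\<^sub>R ((grad f (x (Suc k)) - grad f (x k)) /\<^sub>R h))"
      unfolding h_def q_def a_def assms(16) ..
    also have "\<dots> = - (2 * q * h) *\<^sub>R v (Suc k) - (a * h) *\<^sub>R grad f (x (Suc k))
        - \<Delta>\<^sub>2 *\<^sub>R (grad f (x (Suc k)) - grad f (x k))"
      using h by (simp add: scaleR_diff_right mult.commute mult.left_commute)
    finally show ?thesis .
  qed
  have step: "(1 + r) * E (Suc k) \<le> E k" for k
    unfolding E_def r_def
  proof (rule energy_step[OF assms(3,5,2) _ minimum])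
    show "strongly_convex (q\<^sup>2) f" using assms(4) qq by simp
  qed (use h q a assms(8,10-12) x_next v_step in \<open>auto simp: h_def a_def\<close>)
  have decay: "(1 + r) ^ k * E k \<le> E 0" for k
  proof (induction k)
    case (Suc k)
    have "(1 + r) ^ Suc k * E (Suc k) = (1 + r) ^ k * ((1 + r) * E (Suc k))" by simp
    also have "\<dots> \<le> (1 + r) ^ k * E k" using step r by (intro mult_left_mono) auto
    finally show ?case using Suc by simp
  qed simp
  define c where "c = (1 - L * \<Delta>\<^sub>2 * h) * a"
  have "L * (\<Delta>\<^sub>2 * h) < 1" using assms(2,10) by (simp add: h_def field_simps)
  then have c: "c > 0" using a by (simp add: c_def mult.assoc)
  have "c * (f (x k) - f xstar) \<le> E k"
    using energy_ge_gap[OF assms(3,5,2) minimum, of a \<Delta>\<^sub>2 h "x k" q "v k"] a assms(8) h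
    by (simp add: E_def c_def mult.commute)
  then have "(1 + r) ^ k * (c * (f (x k) - f xstar)) \<le> E 0"
    using decay[of k] r
    by (intro order_trans[OF mult_left_mono[of "c * (f (x k) - f xstar)" "E k"]]) auto
  then have "f (x k) - f xstar \<le> 1 / c * (1 + r) powi (- int k) * E 0"
    using c r by (simp add: power_int_minus field_simps)
  moreover have "sqrt (\<mu> * s) = q * h" by (simp add: q_def h_def real_sqrt_mult)
  moreover have "x 1 = x0 + h *\<^sub>R v0" using x_next[of 0] assms(13,14) by simp
  ultimately show "f (x k) - f xstar \<le>
           1 / ((1 - L * \<Delta>\<^sub>2 * sqrt s) * (1 + \<Delta>\<^sub>1))
           * (1 + sqrt (\<mu> * s) / (1 + sqrt (\<mu> * s))) powi (- int k)
           * ((1 + \<Delta>\<^sub>1) * (f x0 - f xstar - \<Delta>\<^sub>2 * sqrt s / 2 * (norm (grad f x0))\<^sup>2)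
              + 1 / 2 * (norm (v0 + sqrt \<mu> *\<^sub>R (x 1 - xstar) + \<Delta>\<^sub>2 *\<^sub>R grad f x0))\<^sup>2)"
    unfolding E_def energy_def c_def r_def assms(13,14)
    by (simp only: a_def h_def q_def)
qed

end
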